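(* For each $\mu\in(0,1)$ and each $\eta\in(0,1]$ (and given $\varsigma\in(0,1]$), there exists a univariate function $f_{\mu,\eta}:\mathbb{R}\to\mathbb{R}$ which is continuously differentiable, has a Lipschitz continuous derivative and is bounded below, such that the ASTR1 algorithm with $B_k=0$ for all $k$ and scaling factors $$w_k=\Big(\varsigma+\sum_{\ell=0}^k g_\ell^2\Big)^{\mu}\qquad(k\ge0),$$ when applied to minimize $f_{\mu,\eta}$ starting from the origin $x_0=0$, produces (for a choice of steps allowed by the algorithm) a sequence of gradients $g_k=f_{\mu,\eta}'(x_k)$ with $$|g_k|=\frac{1}{k^{\frac12+\eta}}\qquad\text{for all }k\ge1.$$
   Context: ASTR1 algorithm (stated for an objective $f:\mathbb{R}^n\to\mathbb{R}$; used here with $n=1$). Subscript $i,k$ denotes the $i$-th component of a vector at iteration $k$, $\|\cdot\|$ is the Euclidean norm (and induced matrix norm), and $g_k=\nabla f(x_k)$. Given a starting point $x_0\in\mathbb{R}^n$ and constants $\kappa_B\ge1$ and $\tau\in(0,1]$, for $k=0,1,2,\dots$: 1. Compute $g_k$ and define $\Delta_{i,k}=|g_{i,k}|/w_{i,k}$ for $i\in\{1,\dots,n\}$, where the scaling factors $w_{i,k}>0$ depend on $x_0,\dots,x_k$. 2. Select any symmetric matrix $B_k$ with $\|B_k\|\le\kappa_B$. 3. Compute any step $s_k$ such that $|s_{i,k}|\le\Delta_{i,k}$ for all $i\in\{1,\dots,n\}$ and $$g_k^Ts_k+\tfrac12 s_k^TB_ks_k\le\tau\left(g_k^Ts_k^Q+\tfrac12(s_k^Q)^TB_ks_k^Q\right),$$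 where $s_{i,k}^L=-\mathrm{sign}(g_{i,k})\Delta_{i,k}$, $s_k^Q=\gamma_ks_k^L$, and $\gamma_k=\min\left[1,\frac{|g_k^Ts_k^L|}{(s_k^L)^TB_ks_k^L}\right]$ if $(s_k^L)^TB_ks_k^L>0$, $\gamma_k=1$ otherwise. 4. Set $x_{k+1}=x_k+s_k$. The algorithm has no termination rule and generates an infinite sequence. *)

theory Defs
  imports "HOL-Analysis.Analysis"
begin

text \<open>
  The algorithm is stated over an arbitrary Euclidean space, whose \<open>i\<close>-th components are the
  inner products with the elements \<open>i\<close> of \<open>Basis\<close>; on \<open>real\<close> the basis is \<open>{1}\<close>, so the only
  component of \<open>x\<close> is \<open>x\<close> itself. A symmetric matrix is represented by the self-adjoint
  linear map it induces and its norm by the operator norm of that map.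
\<close>

definition quad_model :: "('a::euclidean_space) \<Rightarrow> ('a \<Rightarrow> 'a) \<Rightarrow> 'a \<Rightarrow> real" where
  "quad_model g B s = g \<bullet> s + 1/2 * (s \<bullet> B s)"

definition tr_radius :: "('a::euclidean_space) \<Rightarrow> 'a \<Rightarrow> 'a \<Rightarrow> real" where
  "tr_radius g w i = \<bar>g \<bullet> i\<bar> / (w \<bullet> i)"

definition step_L :: "('a::euclidean_space) \<Rightarrow> 'a \<Rightarrow> 'a" where
  "step_L g w = (\<Sum>i\<in>Basis. (- sgn (g \<bullet> i) * tr_radius g w i) *\<^sub>R i)"

definition cauchy_factor :: "('a::euclidean_space) \<Rightarrow> 'a \<Rightarrow> ('a \<Rightarrow> 'a) \<Rightarrow> real" where
  "cauchy_factor g w B =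
    (let sL = step_L g w in
     if sL \<bullet> B sL > 0 then min 1 (\<bar>g \<bullet> sL\<bar> / (sL \<bullet> B sL)) else 1)"

definition step_Q :: "('a::euclidean_space) \<Rightarrow> 'a \<Rightarrow> ('a \<Rightarrow> 'a) \<Rightarrow> 'a" where
  "step_Q g w B = cauchy_factor g w B *\<^sub>R step_L g w"

text \<open>
  A scaling rule maps a sequence of iterates to a sequence of vectors of scaling factors, where
  the \<open>k\<close>-th vector may depend on the iterates with index at most \<open>k\<close> only.
\<close>

definition nonanticipating :: "((nat \<Rightarrow> 'a) \<Rightarrow> nat \<Rightarrow> 'b) \<Rightarrow> bool" where
  "nonanticipating W \<longleftrightarrow> (\<forall>y z k. (\<forall>l\<le>k. y l = z l) \<longrightarrow> W y k = W z k)"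

text \<open>
  The sequences \<open>x\<close>, \<open>g\<close> and \<open>s\<close> are iterates, gradients and steps that the algorithm may
  generate from \<open>x0\<close> with scaling rule \<open>W\<close> and matrices \<open>B\<close>. This is a relation because the
  steps are not uniquely determined.
\<close>

definition ASTR1_run ::
  "real \<Rightarrow> real \<Rightarrow> (('a::euclidean_space) \<Rightarrow> real) \<Rightarrow> 'a \<Rightarrow> ((nat \<Rightarrow> 'a) \<Rightarrow> nat \<Rightarrow> 'a) \<Rightarrow>
   (nat \<Rightarrow> 'a \<Rightarrow> 'a) \<Rightarrow> (nat \<Rightarrow> 'a) \<Rightarrow> (nat \<Rightarrow> 'a) \<Rightarrow> (nat \<Rightarrow> 'a) \<Rightarrow> bool" where
  "ASTR1_run \<kappa>B \<tau> f x0 W B x g s \<longleftrightarrow>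
    \<kappa>B \<ge> 1 \<and> 0 < \<tau> \<and> \<tau> \<le> 1 \<and> nonanticipating W \<and> x 0 = x0 \<and>
    (\<forall>k. GDERIV f (x k) :> g k \<and>
         (\<forall>i\<in>Basis. W x k \<bullet> i > 0) \<and>
         linear (B k) \<and> (\<forall>u v. B k u \<bullet> v = u \<bullet> B k v) \<and> onorm (B k) \<le> \<kappa>B \<and>
         (\<forall>i\<in>Basis. \<bar>s k \<bullet> i\<bar> \<le> tr_radius (g k) (W x k) i) \<and>
         quad_model (g k) (B k) (s k)
           \<le> \<tau> * quad_model (g k) (B k) (step_Q (g k) (W x k) (B k)) \<and>
         x (Suc k) = x k + s k)"

end

theory Submission
  imports Defs
begin

text \<open>
  With \<open>B = 0\<close> the full step \<open>s = - g / w\<close> is always admissible. Prescribe the gradients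
  \<open>- a k\<close> with \<open>a k = 1 / k powr (1/2 + \<eta>)\<close>. Since the squares of \<open>a\<close> are summable, the scaling
  factors \<open>w k\<close> stay in a compact interval of positive numbers with right end \<open>L\<close>. The step
  lengths \<open>a k / w k\<close> are therefore at least \<open>a k / L\<close>, so that the gradient data at the iterates
  are \<open>L\<close>-Lipschitz and extend to a nonincreasing Lipschitz function \<open>h\<close> on the line. Any
  antiderivative of \<open>- h\<close> decreases along the run by at most the sum of \<open>(a k)\<^sup>2 / w k\<close>,
  which is finite.
\<close>

text \<open>
  A one-sided McShane extension: the usual cone \<open>L * \<bar>x k - t\<bar>\<close> is replaced by a half-cone,
  which makes the extension monotone.
\<close>

lemma antimono_lipschitz_extension:
  fixes a x :: "nat \<Rightarrow> real"
  assumes a: "decseq a" "\<And>k. 0 \<le> a k" and x: "incseq x" and L: "0 \<le> L"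
    and slope: "\<And>k. a k - a (Suc k) \<le> L * (x (Suc k) - x k)"
  obtains h where "antimono h" "L-lipschitz_on UNIV h" "\<And>t. 0 \<le> h t" "\<And>k. h (x k) = a k"
proof
  define c where "c k t = a k + L * max 0 (x k - t)" for k t
  define h where "h t = (INF k. c k t)" for t
  have c_nonneg: "0 \<le> c k t" for k t
    using a(2) L by (simp add: c_def)
  have bdd: "bdd_below (range (\<lambda>k. c k t))" for t
    using c_nonneg by (intro bdd_belowI2)
  have h_le: "h t \<le> c k t" for k t
    unfolding h_def by (rule cINF_lower[OF bdd]) simp
  have h_ge: "b \<le> h t" if "\<And>k. b \<le> c k t" for b t
    unfolding h_def by (rule cINF_greatest) (use that in auto)
  have anti: "h v \<le> h u" if "u \<le> v" for u v
  proof (rule h_ge)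
    fix k
    have "L * max 0 (x k - v) \<le> L * max 0 (x k - u)"
      using that L by (intro mult_left_mono) auto
    then show "h v \<le> c k u"
      using h_le[of v k] by (simp add: c_def)
  qed
  then show "antimono h"
    by (simp add: antimono_def)
  \<comment> \<open>Moving left from \<open>v\<close> to \<open>u\<close> raises every half-cone by
    at most \<open>L * (v - u)\<close>; being uniform in \<open>k\<close>, the bound passes to the
    infimum.\<close>
  have drop: "h u - h v \<le> L * (v - u)" if "u \<le> v" for u v
  proof -
    have "h u - L * (v - u) \<le> h v"
    proof (rule h_ge)
      fix k
      have "L * max 0 (x k - u) \<le> L * (max 0 (x k - v) + (v - u))"
        using that L by (intro mult_left_mono) auto
      then show "h u - L * (v - u) \<le> c k v"
        using h_le[of u k] by (simp add: c_def distrib_left)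
    qed
    then show ?thesis by simp
  qed
  show "L-lipschitz_on UNIV h"
  proof (rule lipschitz_onI)
    show "dist (h u) (h v) \<le> L * dist u v" for u v
      using anti[of u v] anti[of v u] drop[of u v] drop[of v u]
      by (cases "u \<le> v") (auto simp: dist_real_def abs_real_def)
  qed (rule L)
  show "0 \<le> h t" for t
    by (rule h_ge) (rule c_nonneg)
  show "h (x k) = a k" for k
  proof (rule antisym)
    show "h (x k) \<le> a k"
      using h_le[of "x k" k] by (simp add: c_def)
    show "a k \<le> h (x k)"
    proof (rule h_ge)
      fix j
      show "a k \<le> c j (x k)"
      proof (cases "j \<le> k")
        case True
        then show ?thesis
          using decseqD[OF a(1)] L by (simp add: c_def add_increasing2)
      next
        case False
        \<comment> \<open>Monotonicity of this sequence carries the slope bound from consecutive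
          points to all pairs \<open>k < j\<close>.\<close>
        have "incseq (\<lambda>i. a i + L * x i)"
          using slope by (intro incseq_SucI) (simp add: algebra_simps)
        then have "a k + L * x k \<le> a j + L * x j"
          using incseqD[of _ k j] False by simp
        moreover have "x k \<le> x j"
          using False incseqD[OF x] by simp
        ultimately show ?thesis
          by (simp add: c_def right_diff_distrib)
      qed
    qed
  qed
qed

lemma continuous_antiderivative:
  fixes h :: "real \<Rightarrow> real"
  assumes "continuous_on UNIV h"
  obtains F where "\<And>t. (F has_real_derivative h t) (at t)"
proof -
  have "\<exists>F. \<forall>t. -\<infinity> < ereal t \<longrightarrow> ereal t < \<infinity> \<longrightarrow> (F has_vector_derivative h t) (at t)"
    by (rule einterval_antiderivative)
      (use assms in \<open>auto simp: continuous_on_eq_continuous_at\<close>)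
  then show ?thesis
    using that by (auto simp: has_real_derivative_iff_has_vector_derivative)
qed

text \<open>\<open>F\<close> is concave, so to the right of \<open>u\<close> it stays below its
  tangent at \<open>u\<close>.\<close>

lemma antimono_derivative_le:
  fixes F h :: "real \<Rightarrow> real"
  assumes F: "\<And>t. (F has_real_derivative h t) (at t)" and h: "antimono h" and "u \<le> v"
  shows "F v - F u \<le> h u * (v - u)"
proof (cases "u = v")
  case False
  then have "u < v" using \<open>u \<le> v\<close> by simp
  from MVT2[OF this] obtain z where "u < z" "F v - F u = (v - u) * h z"
    using F by blast
  moreover have "h z \<le> h u"
    using h \<open>u < z\<close> by (simp add: antimono_def)
  ultimately show ?thesis
    using \<open>u < v\<close> by (simp add: mult.commute mult_left_mono)
qed simp

text \<open>Telescoping the tangent bounds controls \<open>F\<close> at the iterates by a convergent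
  series. The iterates may converge to a finite point (in the application they do iff
  \<open>\<eta> > 1/2\<close>), so points beyond all of them need the limit of
  \<open>h (x k)\<close>.\<close>

lemma bdd_above_antiderivative:
  fixes F h :: "real \<Rightarrow> real" and x :: "nat \<Rightarrow> real"
  assumes F: "\<And>t. (F has_real_derivative h t) (at t)" and h: "antimono h" "\<And>t. 0 \<le> h t"
    and x: "incseq x" and sm: "summable (\<lambda>k. h (x k) * (x (Suc k) - x k))"
    and lim: "(\<lambda>k. h (x k)) \<longlonglongrightarrow> 0"
  shows "bdd_above (range F)"
proof (rule bdd_aboveI2)
  let ?d = "\<lambda>k. h (x k) * (x (Suc k) - x k)"
  have nn: "0 \<le> ?d k" for k
    using h(2) incseq_SucD[OF x] by simp
  have iter: "F (x k) \<le> F (x 0) + suminf ?d" for k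
  proof -
    have "F (x k) \<le> F (x 0) + sum ?d {..<k}"
    proof (induction k)
      case (Suc k)
      then show ?case
        using antimono_derivative_le[OF F h(1) incseq_SucD[OF x, of k]] by simp
    qed simp
    also have "\<dots> \<le> F (x 0) + suminf ?d"
      using sum_le_suminf[OF sm, of "{..<k}"] nn by simp
    finally show ?thesis .
  qed
  show "F t \<le> F (x 0) + suminf ?d" for t
  proof -
    \<comment> \<open>The last term pays for the tangent at \<open>x k\<close> when \<open>t\<close>
      lies to its right. The bound holds for every \<open>k\<close>, so this term vanishes in the
      limit.\<close>
    have bound: "F t \<le> F (x 0) + suminf ?d + h (x k) * max 0 (t - x 0)" for k
    proof (cases "x k \<le> t")
      case True
      have "F t \<le> F (x k) + h (x k) * (t - x k)"
        using antimono_derivative_le[OF F h(1) True] by simp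
      moreover have "h (x k) * (t - x k) \<le> h (x k) * max 0 (t - x 0)"
        using h(2) incseqD[OF x, of 0 k] by (intro mult_left_mono) auto
      ultimately show ?thesis
        using iter[of k] by simp
    next
      case False
      have "F t \<le> F (x k)"
        by (rule DERIV_nonneg_imp_nondecreasing) (use False F h(2) in auto)
      then show ?thesis
        using iter[of k] h(2)[of "x k"] by (simp add: add_increasing2)
    qed
    have "(\<lambda>k. F (x 0) + suminf ?d + h (x k) * max 0 (t - x 0)) \<longlonglongrightarrow>
        F (x 0) + suminf ?d + 0 * max 0 (t - x 0)"
      by (intro tendsto_intros lim)
    from LIMSEQ_le_const[OF this, of "F t"] show ?thesis
      using bound by simp
  qed
qed

text \<open>Zero curvature makes the Cauchy factor 1, so \<open>step_Q\<close> is itself the full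
  step. Its model value is \<open>- g * g / w\<close>, which is nonpositive, so multiplying it by
  \<open>\<tau> \<le> 1\<close> can only increase it.\<close>

lemma ASTR1_run_full_step:
  fixes f f' :: "real \<Rightarrow> real"
  assumes \<kappa>\<tau>: "\<kappa>B \<ge> 1" "0 < \<tau>" "\<tau> \<le> 1"
    and W: "nonanticipating W" "\<And>k. W x k > 0"
    and deriv: "\<And>t. (f has_real_derivative f' t) (at t)"
    and x: "x 0 = x0" "\<And>k. x (Suc k) = x k - f' (x k) / W x k"
  shows "ASTR1_run \<kappa>B \<tau> f x0 W (\<lambda>k v. 0) x (\<lambda>k. f' (x k)) (\<lambda>k. - f' (x k) / W x k)"
proof -
  have grad: "GDERIV f t :> f' t" for t
    using deriv[of t] by (simp add: gderiv_def has_field_derivative_def mult.commute)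
  have "step_L g w = - g / w" for g w :: real
    by (simp add: step_L_def tr_radius_def sgn_mult_abs)
  then have Q: "step_Q g w (\<lambda>v. 0) = - g / w" for g w :: real
    by (simp add: step_Q_def cauchy_factor_def)
  have "quad_model g (\<lambda>v. 0) (- g / w) \<le> \<tau> * quad_model g (\<lambda>v. 0) (- g / w)"
    if "w > 0" for g w :: real
  proof -
    have "\<tau> * (g * g / w) \<le> g * g / w"
      using \<kappa>\<tau> that by (intro mult_left_le_one_le) auto
    then show ?thesis
      by (simp add: quad_model_def)
  qed
  then show ?thesis
    using \<kappa>\<tau> W x grad unfolding ASTR1_run_def
    by (simp add: Q linear_zero onorm_zero tr_radius_def less_imp_le)
qed

theorem theorem3p3:
  fixes \<mu> \<eta> \<sigma> :: real
  assumes "0 < \<mu>" "\<mu> < 1"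
    and "0 < \<eta>" "\<eta> \<le> 1"
    and "0 < \<sigma>" "\<sigma> \<le> 1"
  shows "\<exists>(f :: real \<Rightarrow> real) (f' :: real \<Rightarrow> real).
    (\<forall>t. (f has_real_derivative f' t) (at t)) \<and>
    continuous_on UNIV f' \<and>
    (\<exists>L. L-lipschitz_on UNIV f') \<and>
    bdd_below (range f) \<and>
    (\<forall>\<kappa>B \<tau>. \<kappa>B \<ge> 1 \<and> 0 < \<tau> \<and> \<tau> \<le> 1 \<longrightarrow>
      (\<exists>x g s.
        ASTR1_run \<kappa>B \<tau> f 0
          (\<lambda>y k. (\<sigma> + (\<Sum>l\<le>k. (f' (y l))\<^sup>2)) powr \<mu>)
          (\<lambda>k v. 0) x g s \<and>
        (\<forall>k\<ge>1. \<bar>g k\<bar> = 1 / real k powr (1/2 + \<eta>))))"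
proof -
  \<comment> \<open>The \<open>max\<close> sets \<open>a 0 = 1\<close>; as
    \<open>0 powr r = 0\<close>, the bare formula would vanish at 0 and \<open>a\<close> would be
    neither positive nor nonincreasing.\<close>
  define a where "a k = real (max 1 k) powr - (1/2 + \<eta>)" for k :: nat
  \<comment> \<open>The factors come from the prescribed data, not from gradients, so the iterates
    are fixed before the objective exists.\<close>
  define w where "w k = (\<sigma> + (\<Sum>l\<le>k. (a l)\<^sup>2)) powr \<mu>" for k
  define x where "x k = (\<Sum>l<k. a l / w l)" for k
  define L where "L = (\<sigma> + (\<Sum>l. (a l)\<^sup>2)) powr \<mu>"
  have a_pos: "0 < a k" for k
    by (simp add: a_def)
  have a_dec: "decseq a"
    unfolding a_def decseq_def using \<open>0 < \<eta>\<close> by (auto intro!: powr_mono2')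
  have a_sq: "(a k)\<^sup>2 = real k powr - (1 + 2 * \<eta>)" if "k \<ge> 1" for k
  proof -
    have "2 * - (1/2 + \<eta>) = - (1 + 2 * \<eta>)"
      by simp
    then show ?thesis
      using that by (simp add: a_def powr_power max_absorb2 del: minus_add_distrib)
  qed
  have sum_sq: "summable (\<lambda>k. (a k)\<^sup>2)"
  proof -
    \<comment> \<open>Here \<open>\<eta> > 0\<close> is decisive: the exponent must lie strictly
      below -1.\<close>
    have "summable (\<lambda>k. real k powr - (1 + 2 * \<eta>))"
      using \<open>0 < \<eta>\<close> by (simp add: summable_real_powr_iff)
    then show ?thesis
      by (rule summable_cong[THEN iffD1, rotated])
        (auto simp: a_sq intro!: eventually_sequentiallyI[of 1])
  qed
  have a_lim: "a \<longlonglongrightarrow> 0"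
    using summable_LIMSEQ_zero[OF sum_sq] by (simp add: tendsto_null_power)
  have part_le: "(\<Sum>l\<le>k. (a l)\<^sup>2) \<le> (\<Sum>l. (a l)\<^sup>2)" for k
    by (rule sum_le_suminf[OF sum_sq]) auto
  have w_ge: "\<sigma> powr \<mu> \<le> w k" for k
    unfolding w_def using assms by (intro powr_mono2) (auto intro: sum_nonneg)
  have w_pos: "0 < w k" for k
    using w_ge[of k] \<open>0 < \<sigma>\<close> by (smt (verit) powr_gt_zero)
  have w_le: "w k \<le> L" for k
    unfolding w_def L_def using assms part_le
    by (intro powr_mono2) (auto intro!: add_nonneg_nonneg sum_nonneg)
  have x_Suc: "x (Suc k) = x k + a k / w k" for k
    by (simp add: x_def)
  have x_inc: "incseq x"
    using a_pos w_pos by (intro incseq_SucI) (simp add: x_Suc less_imp_le)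
  have L_nonneg: "0 \<le> L"
    by (simp add: L_def)
  have slope: "a k - a (Suc k) \<le> L * (x (Suc k) - x k)" for k
  proof -
    \<comment> \<open>The drop is at most \<open>a k\<close>, which is \<open>w k\<close> times the
      step length.\<close>
    have "a k - a (Suc k) \<le> w k * (a k / w k)"
      using a_pos[of "Suc k"] w_pos[of k] by simp
    also have "\<dots> \<le> L * (a k / w k)"
      using w_le a_pos[of k] w_pos[of k] by (intro mult_right_mono) auto
    finally show ?thesis
      by (simp add: x_Suc)
  qed
  obtain h where h: "antimono h" "L-lipschitz_on UNIV h" "\<And>t. 0 \<le> h t" "\<And>k. h (x k) = a k"
    using antimono_lipschitz_extension[OF a_dec _ x_inc L_nonneg slope] a_pos
    by (metis less_imp_le)
  have cont: "continuous_on UNIV h"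
    using h(2) by (rule lipschitz_on_continuous_on)
  then obtain F where F: "\<And>t. (F has_real_derivative h t) (at t)"
    using continuous_antiderivative by blast
  define f' where "f' t = - h t" for t
  have deriv: "((\<lambda>t. - F t) has_real_derivative f' t) (at t)" for t
    unfolding f'_def by (intro derivative_intros F)
  have "summable (\<lambda>k. h (x k) * (x (Suc k) - x k))"
  \<comment> \<open>Each term equals \<open>(a k)\<^sup>2 / w k\<close>, and \<open>w k\<close> is
    at least \<open>\<sigma> powr \<mu>\<close>.\<close>
  proof (rule summable_comparison_test')
    show "summable (\<lambda>k. (a k)\<^sup>2 / \<sigma> powr \<mu>)"
      by (intro summable_divide sum_sq)
    show "norm (h (x k) * (x (Suc k) - x k)) \<le> (a k)\<^sup>2 / \<sigma> powr \<mu>" for k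
      using a_pos[of k] w_pos[of k] w_ge[of k] \<open>0 < \<sigma>\<close>
      by (simp add: h(4) x_Suc power2_eq_square frac_le)
  qed
  then have "bdd_above (range F)"
    using bdd_above_antiderivative[OF F h(1,3) x_inc] a_lim by (simp add: h(4))
  then have bdd: "bdd_below (range (\<lambda>t. - F t))"
    by (auto simp: bdd_above_def bdd_below_def) (metis neg_le_iff_le)
  let ?W = "\<lambda>y k. (\<sigma> + (\<Sum>l\<le>k. (f' (y l))\<^sup>2)) powr \<mu>"
  \<comment> \<open>This closes the circle: since \<open>h\<close> interpolates \<open>a\<close> at
    the iterates, the scaling rule returns the factors from which \<open>x\<close> was
    built.\<close>
  have W: "?W x = w"
    by (simp add: f'_def h(4) w_def fun_eq_iff)
  have nonant: "nonanticipating ?W"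
    by (auto simp: nonanticipating_def)
  have run: "ASTR1_run \<kappa>B \<tau> (\<lambda>t. - F t) 0 ?W (\<lambda>k v. 0) x (\<lambda>k. f' (x k)) (\<lambda>k. - f' (x k) / ?W x k)"
    if "\<kappa>B \<ge> 1" "0 < \<tau>" "\<tau> \<le> 1" for \<kappa>B \<tau>
  proof (rule ASTR1_run_full_step[OF that nonant _ deriv])
    show "0 < ?W x k" for k
      using fun_cong[OF W] w_pos by simp
    show "x 0 = 0"
      by (simp add: x_def)
    show "x (Suc k) = x k - f' (x k) / ?W x k" for k
      using fun_cong[OF W, of k] by (simp add: x_Suc f'_def h(4))
  qed
  have g: "\<bar>f' (x k)\<bar> = 1 / real k powr (1/2 + \<eta>)" if "k \<ge> 1" for k
    using that by (simp add: f'_def h(4) a_def max_absorb2 powr_minus_divide del: minus_add_distrib)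
  show ?thesis
  proof (rule exI[of _ "\<lambda>t. - F t"], rule exI[of _ f'], intro conjI)
    show "\<exists>L. L-lipschitz_on UNIV f'"
      unfolding f'_def using lipschitz_on_minus[OF h(2)] by blast
    show "continuous_on UNIV f'"
      unfolding f'_def by (intro continuous_intros cont)
    show "\<forall>t. ((\<lambda>t. - F t) has_real_derivative f' t) (at t)"
      using deriv by blast
    show "bdd_below (range (\<lambda>t. - F t))"
      by (rule bdd)
    show "\<forall>\<kappa>B \<tau>. \<kappa>B \<ge> 1 \<and> 0 < \<tau> \<and> \<tau> \<le> 1 \<longrightarrow>
      (\<exists>x g s. ASTR1_run \<kappa>B \<tau> (\<lambda>t. - F t) 0 ?W (\<lambda>k v. 0) x g s \<and>
        (\<forall>k\<ge>1. \<bar>g k\<bar> = 1 / real k powr (1/2 + \<eta>)))"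
      by (intro allI impI exI conjI) (use run g in auto)
  qed
qed

end
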